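(* Let $A,B:\mathcal H\rightrightarrows\mathcal H$ be maximal $\alpha$-comonotone and maximal $\beta$-comonotone, respectively, with $\alpha+\beta\ge0$ and $\operatorname{zer}(A+B)\ne\emptyset$. Let $(\gamma,\delta,\lambda,\mu)\in\mathbb R_{++}^2\times(1,+\infty)^2$ be such that $$(\lambda-1)(\mu-1)=1\quad\text{and}\quad\delta=\gamma(\lambda-1),$$ and $$\begin{cases}\delta=\gamma+2\alpha &\text{if }\alpha+\beta=0,\\ (\gamma+\delta)^2<4(\gamma+\alpha)(\delta+\beta)&\text{if }\alpha+\beta>0.\end{cases}$$ Set $\kappa\in(0,\kappa^* )$, where $$\kappa^*:=\begin{cases}1&\text{if }\alpha+\beta=0,\\ \dfrac{4(\gamma+\alpha)(\delta+\beta)-(\gamma+\delta)^2}{2(\gamma+\delta)(\alpha+\beta)}&\text{if }\alpha+\beta>0.\end{cases}$$ Let $\{(x^k,y^k,z^k)\}$ be generated, for an arbitrary initial point $x^0\in\mathcal H$, by $$y^k\in J_{\gamma A}(x^k),\qquad z^k\in J_{\delta B}((1-\lambda)x^k+\lambda y^k),\qquad x^{k+1}=x^k+\kappa\mu(z^k-y^k).$$ Then: (i) There exists $\bar x\in\operatorname{Fix}(T_{A,B})$ with $J_{\gamma A}(\bar x)\in\operatorname{zer}(A+B)$ such that $x^k\rightharpoonup\bar x$; (ii) $\|x^k-x^{k+1}\|=o(1/\sqrt k)$ and $\|y^k-y^{k+1}\|=o(1/\sqrt k)$ as $k\to\infty$; (iii) the sequences $\{y^k\}$ and $\{z^k\}$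 converge weakly to $J_{\gamma A}(\bar x)$; and (iv) if $\alpha+\beta>0$, $0<\kappa<1$ and either (a) $\gamma+2\alpha>0$ and $\kappa^*\ge1$, or (b) $\gamma=\delta>0$, $\lambda=\mu=2$, and $\kappa^*>\kappa$, then the sequences $\{x^k-y^k\}$ and $\{x^k-z^k\}$ converge strongly to $\gamma\,{}^{\gamma}A(\bar x)=\bar x-J_{\gamma A}(\bar x)$, and $\gamma\,{}^{\gamma}A(\bar x)+\operatorname{zer}(A+B)=\operatorname{Fix}(T_{A,B})$.
   Context: $\mathcal H$ is a real Hilbert space; $\to$ and $\rightharpoonup$ denote strong and weak convergence. For a set-valued operator $A:\mathcal H\rightrightarrows\mathcal H$ (values may be empty), $\operatorname{gra}(A)=\{(x,u):u\in A(x)\}$, $\operatorname{zer}(A)=\{x:0\in A(x)\}$, $\operatorname{Fix}(A)=\{x:x\in A(x)\}$. For $\sigma\in\mathbb R$, $A$ is $\sigma$-comonotone if $\langle x-y,u-v\rangle\ge\sigma\|u-v\|^2$ for all $(x,u),(y,v)\in\operatorname{gra}(A)$, and maximal $\sigma$-comonotone if moreover no $\sigma$-comonotone operator has a graph properly containing $\operatorname{gra}(A)$. The resolvent is $J_{\gamma A}=(\mathrm{Id}+\gamma A)^{-1}$, the relaxed resolvent is $J_{\gamma A}^\lambda=\lambda J_{\gamma A}+(1-\lambda)\mathrm{Id}$, the Yosida approximation is ${}^{\gamma}A=\frac1\gamma(\mathrm{Id}-J_{\gamma A})$. The adaptive Douglas–Rachford operator is $T_{A,B}=(1-\kappa)\mathrm{Id}+\kappa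 J_{\delta B}^{\mu}J_{\gamma A}^{\lambda}$. *)

theory Defs
  imports "HOL-Analysis.Analysis" "HOL-Library.Landau_Symbols"
begin

text \<open>
  A set-valued operator on \<open>H\<close> is a function \<open>H \<Rightarrow> H set\<close>; single-valued operators
  are those whose values are singletons.  Real Hilbert spaces are the types of sort
  \<open>{real_inner, complete_space}\<close>.
\<close>

type_synonym 'a operator = "'a \<Rightarrow> 'a set"

definition gra :: "'a operator \<Rightarrow> ('a \<times> 'a) set" where
  "gra A = {(x, u). u \<in> A x}"

definition zer :: "'a::zero operator \<Rightarrow> 'a set" where
  "zer A = {x. 0 \<in> A x}"

definition Fix :: "'a operator \<Rightarrow> 'a set" where
  "Fix A = {x. x \<in> A x}"

definition op_id :: "'a operator" where
  "op_id x = {x}"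

definition op_add :: "'a::plus operator \<Rightarrow> 'a operator \<Rightarrow> 'a operator" where
  "op_add A B x = {u + v |u v. u \<in> A x \<and> v \<in> B x}"

definition op_scale :: "real \<Rightarrow> 'a::real_vector operator \<Rightarrow> 'a operator" where
  "op_scale c A x = {c *\<^sub>R u |u. u \<in> A x}"

definition op_inverse :: "'a operator \<Rightarrow> 'a operator" where
  "op_inverse A u = {x. u \<in> A x}"

definition op_comp :: "'a operator \<Rightarrow> 'a operator \<Rightarrow> 'a operator" where
  "op_comp B A x = (\<Union>y\<in>A x. B y)"

definition comonotone :: "real \<Rightarrow> 'a::real_inner operator \<Rightarrow> bool" where
  "comonotone \<sigma> A \<longleftrightarrow>
     (\<forall>(x, u)\<in>gra A. \<forall>(y, v)\<in>gra A. inner (x - y) (u - v) \<ge> \<sigma> * (norm (u - v))\<^sup>2)"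

definition maximal_comonotone :: "real \<Rightarrow> 'a::real_inner operator \<Rightarrow> bool" where
  "maximal_comonotone \<sigma> A \<longleftrightarrow>
     comonotone \<sigma> A \<and> \<not> (\<exists>C. comonotone \<sigma> C \<and> gra A \<subset> gra C)"

definition resolvent :: "real \<Rightarrow> 'a::real_vector operator \<Rightarrow> 'a operator" where
  "resolvent \<gamma> A = op_inverse (op_add op_id (op_scale \<gamma> A))"

definition relaxed_resolvent :: "real \<Rightarrow> real \<Rightarrow> 'a::real_vector operator \<Rightarrow> 'a operator" where
  "relaxed_resolvent \<gamma> lam A =
     op_add (op_scale lam (resolvent \<gamma> A)) (op_scale (1 - lam) op_id)"

definition yosida :: "real \<Rightarrow> 'a::real_vector operator \<Rightarrow> 'a operator" where
  "yosida \<gamma> A = op_scale (1 / \<gamma>) (op_add op_id (op_scale (- 1) (resolvent \<gamma> A)))"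

definition adaptive_DR ::
    "real \<Rightarrow> real \<Rightarrow> real \<Rightarrow> real \<Rightarrow> real \<Rightarrow> 'a::real_vector operator \<Rightarrow> 'a operator \<Rightarrow> 'a operator"
  where
  "adaptive_DR \<gamma> \<delta> lam \<mu> \<kappa> A B =
     op_add (op_scale (1 - \<kappa>) op_id)
       (op_scale \<kappa> (op_comp (relaxed_resolvent \<delta> \<mu> B) (relaxed_resolvent \<gamma> lam A)))"

text \<open>Only meaningful for \<open>\<alpha> + \<beta> \<ge> 0\<close>.\<close>

definition kappa_star :: "real \<Rightarrow> real \<Rightarrow> real \<Rightarrow> real \<Rightarrow> real" where
  "kappa_star \<alpha> \<beta> \<gamma> \<delta> =
     (if \<alpha> + \<beta> = 0 then 1
      else (4 * (\<gamma> + \<alpha>) * (\<delta> + \<beta>) - (\<gamma> + \<delta>)\<^sup>2) / (2 * (\<gamma> + \<delta>) * (\<alpha> + \<beta>)))"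

text \<open>On a Hilbert space the weak topology is the one induced by the functionals
  \<open>\<langle>\<cdot>, w\<rangle>\<close>, since these are all the continuous linear functionals (Riesz).\<close>

definition weakly_converges :: "(nat \<Rightarrow> 'a::real_inner) \<Rightarrow> 'a \<Rightarrow> bool" where
  "weakly_converges x l \<longleftrightarrow> (\<forall>w. (\<lambda>k. inner (x k) w) \<longlonglongrightarrow> inner l w)"

end

theory Submission
  imports Defs "HOL-Library.Diagonal_Subsequence"
begin

text \<open>
  Put \<open>u\<^sub>k = (x\<^sub>k - y\<^sub>k) / \<gamma> \<in> A y\<^sub>k\<close> and \<open>v\<^sub>k \<in> B z\<^sub>k\<close> likewise. The parameter relations turn the iteration into
  \<open>z\<^sub>k = y\<^sub>k - \<delta> (u\<^sub>k + v\<^sub>k)\<close> and \<open>x\<^sub>k\<^sub>+\<^sub>1 = x\<^sub>k - \<kappa> (\<gamma> + \<delta>) (u\<^sub>k + v\<^sub>k)\<close>, and the fixed points are the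
  points \<open>p + \<gamma> q\<close> with \<open>q \<in> A p\<close>, \<open>- q \<in> B p\<close>. Expanding the square and completing it in the
  comonotonicity inequalities shows that one step decreases the squared distance of two
  trajectories by a positive multiple of \<open>\<parallel>\<Delta>(u + v)\<parallel>\<^sup>2\<close> plus, if \<open>\<alpha> + \<beta> > 0\<close>, a positive multiple of
  \<open>\<parallel>(\<gamma> + 2\<alpha> - \<delta>) \<Delta>u - (\<delta> + 2\<beta> - \<gamma>) \<Delta>v\<parallel>\<^sup>2\<close>. Hence the steps are square summable and nonincreasing in
  norm, which gives the rates. Weak cluster points of \<open>(y\<^sub>k, u\<^sub>k)\<close> lie in both graphs directly by
  maximality, so Minty's theorem is not needed, and Opial's argument gives weak convergence. The
  second term yields \<open>2 (\<alpha> + \<beta>) \<Delta>u \<rightarrow> 0\<close>, that is, strong convergence of \<open>u\<^sub>k\<close>.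
\<close>

section \<open>Decay of monotone summable real sequences\<close>

text \<open>At least half of the indices below \<open>k\<close> lie in \<open>{k div 2..<k}\<close>,
  and each term there is at least \<open>a k\<close>. So \<open>k * a k\<close> is at most twice a
  block between two partial sums with the same limit.\<close>

lemma decseq_summable_imp_times_tendsto_0:
  fixes a :: "nat \<Rightarrow> real"
  assumes "decseq a" and nonneg: "\<And>k. 0 \<le> a k" and "summable a"
  shows "(\<lambda>k. real k * a k) \<longlonglongrightarrow> 0"
proof -
  have half: "filterlim (\<lambda>k::nat. k div 2) sequentially sequentially"
    unfolding filterlim_at_top
  proof
    fix Z show "\<forall>\<^sub>F x in sequentially. Z \<le> x div 2"
      using eventually_ge_at_top[of "2 * Z"] by eventually_elim linarith
  qed
  have sums: "(\<lambda>k. \<Sum>i<k. a i) \<longlonglongrightarrow> suminf a"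
    using assms(3) summable_LIMSEQ by blast
  have "(\<lambda>k. 2 * ((\<Sum>i<k. a i) - (\<Sum>i<k div 2. a i))) \<longlonglongrightarrow> 2 * (suminf a - suminf a)"
    by (intro tendsto_intros sums filterlim_compose[OF sums half])
  then have lim: "(\<lambda>k. 2 * ((\<Sum>i<k. a i) - (\<Sum>i<k div 2. a i))) \<longlonglongrightarrow> 0"
    by simp
  have bound: "real k * a k \<le> 2 * ((\<Sum>i<k. a i) - (\<Sum>i<k div 2. a i))" for k
  proof -
    have "real k \<le> 2 * real (card {k div 2..<k})" by simp
    from mult_right_mono[OF this nonneg[of k]]
    have "real k * a k \<le> 2 * (real (card {k div 2..<k}) * a k)" by (simp only: mult.assoc)
    also have "real (card {k div 2..<k}) * a k \<le> (\<Sum>i\<in>{k div 2..<k}. a i)"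
      by (rule sum_bounded_below) (use \<open>decseq a\<close> in \<open>auto simp: decseq_def\<close>)
    also have "(\<Sum>i\<in>{k div 2..<k}. a i) = (\<Sum>i<k. a i) - (\<Sum>i<k div 2. a i)"
      using sum_diff_nat_ivl[of 0 "k div 2" k a] by (simp add: atLeast0LessThan)
    finally show ?thesis by simp
  qed
  show ?thesis
    by (rule tendsto_sandwich[OF _ _ tendsto_const lim]) (use nonneg bound in auto)
qed

section \<open>Weak sequential compactness in Hilbert space\<close>

text \<open>\<open>L\<close> is controlled only on \<open>M\<close>, and \<open>M\<close> may fail
  to be closed, so the representing vector is sought in the closure. The result serves twice: for
  the limit functional on the span of a sequence, and for the orthogonal projection of a vector onto
  the closed span.\<close>

lemma riesz_on_subspace:
  fixes L :: "'a::{real_inner, complete_space} \<Rightarrow> real"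
  assumes M: "subspace M"
    and add: "\<And>x y. x \<in> M \<Longrightarrow> y \<in> M \<Longrightarrow> L (x + y) = L x + L y"
    and scale: "\<And>c x. x \<in> M \<Longrightarrow> L (c *\<^sub>R x) = c * L x"
    and bound: "\<And>x. x \<in> M \<Longrightarrow> \<bar>L x\<bar> \<le> C * norm x"
  shows "\<exists>p\<in>closure M. \<forall>m\<in>M. L m = inner p m"
proof -
  \<comment> \<open>\<open>p\<close> is the minimizer of \<open>f\<close>; minimizing sequences are Cauchy by the parallelogram law.\<close>
  define f where "f m = inner m m - 2 * L m" for m
  define I where "I = Inf (f ` M)"
  have lower: "- (C\<^sup>2) \<le> f m" if "m \<in> M" for m
  proof -
    have "0 \<le> (norm m - C)\<^sup>2" by simp
    then show ?thesis
      using bound[OF that] by (simp add: f_def power2_eq_square dot_square_norm algebra_simps)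
  qed
  have bdd: "bdd_below (f ` M)" using lower by (auto intro!: bdd_belowI)
  have ne: "f ` M \<noteq> {}" using subspace_0[OF M] by auto
  have I_le: "I \<le> f m" if "m \<in> M" for m
    unfolding I_def using bdd that by (intro cInf_lower) auto
  have "\<exists>w\<in>M. f w < I + 1 / real (Suc n)" for n
    using cInf_lessD[OF ne, of "I + 1 / real (Suc n)"] by (auto simp: I_def)
  then obtain w where wM: "\<And>n. w n \<in> M" and fw: "\<And>n. f (w n) < I + 1 / real (Suc n)"
    by metis
  have dist_le: "(dist (w i) (w j))\<^sup>2 \<le> 2 / real (Suc i) + 2 / real (Suc j)" for i j
  proof -
    have mid: "(1/2) *\<^sub>R (w i + w j) \<in> M"
      by (intro subspace_scale subspace_add M wM)
    have "f ((1/2) *\<^sub>R (w i + w j)) =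
        (1/4) * inner (w i + w j) (w i + w j) - (L (w i) + L (w j))"
      using add[OF wM wM, of i j] scale[OF subspace_add[OF M wM wM], of "1/2" i j]
      unfolding f_def inner_scaleR_left inner_scaleR_right by simp
    then have "(dist (w i) (w j))\<^sup>2 =
        2 * f (w i) + 2 * f (w j) - 4 * f ((1/2) *\<^sub>R (w i + w j))"
      by (simp add: f_def dist_norm power2_norm_eq_inner inner_add inner_diff inner_commute
          algebra_simps)
    then show ?thesis using fw[of i] fw[of j] I_le[OF mid] by simp
  qed
  have "Cauchy w"
  proof (rule metric_CauchyI)
    fix e :: real assume "e > 0"
    obtain N :: nat where N: "4 / e\<^sup>2 < real N" using reals_Archimedean2 by blast
    have small: "2 / real (Suc k) < e\<^sup>2 / 2" if "k \<ge> N" for k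
    proof -
      have "4 / e\<^sup>2 < real (Suc k)" using N that by simp
      then show ?thesis using \<open>e > 0\<close> by (simp add: field_simps)
    qed
    have "dist (w m) (w n) < e" if "m \<ge> N" "n \<ge> N" for m n
    proof -
      have "(dist (w m) (w n))\<^sup>2 < e\<^sup>2" using dist_le[of m n] small[OF that(1)] small[OF that(2)] by linarith
      then show ?thesis using \<open>e > 0\<close> by (simp add: power2_less_imp_less)
    qed
    then show "\<exists>N. \<forall>m\<ge>N. \<forall>n\<ge>N. dist (w m) (w n) < e" by blast
  qed
  then obtain p where p: "w \<longlonglongrightarrow> p" using Cauchy_convergent convergent_def by blast
  have "p \<in> closure M" using p wM closure_sequential by blast
  moreover have "L m = inner p m" if m: "m \<in> M" for m
  proof -
    define D where "D = inner p m - L m"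
    \<comment> \<open>First variation in the direction \<open>m\<close>:
      \<open>f (w n + t *\<^sub>R m)\<close> is at least the infimum, while \<open>f (w n)\<close>
      exceeds it by less than \<open>1 / Suc n\<close>. Letting \<open>n\<close> grow leaves a
      polynomial in \<open>t\<close> that is nonnegative everywhere.\<close>
    have var: "0 \<le> 2 * t * D + t\<^sup>2 * inner m m" for t
    proof -
      have nonneg: "0 \<le> 1 / real (Suc n) + 2 * t * (inner (w n) m - L m) + t\<^sup>2 * inner m m" for n
      proof -
        have tm: "w n + t *\<^sub>R m \<in> M" by (intro subspace_add subspace_scale M wM m)
        have "f (w n + t *\<^sub>R m) = f (w n) + 2 * t * (inner (w n) m - L m) + t\<^sup>2 * inner m m"
          using add[OF wM[of n] subspace_scale[OF M m, of t]] scale[OF m, of t]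
          by (simp add: f_def inner_add inner_commute power2_eq_square algebra_simps)
        then show ?thesis using I_le[OF tm] fw[of n] by linarith
      qed
      have lim: "(\<lambda>n. 1 / real (Suc n) + 2 * t * (inner (w n) m - L m) + t\<^sup>2 * inner m m)
          \<longlonglongrightarrow> 0 + 2 * t * (inner p m - L m) + t\<^sup>2 * inner m m"
        by (intro tendsto_intros p LIMSEQ_Suc[OF lim_1_over_n])
      have "0 \<le> 0 + 2 * t * (inner p m - L m) + t\<^sup>2 * inner m m"
        by (rule LIMSEQ_le_const[OF lim]) (use nonneg in blast)
      then show ?thesis by (simp add: D_def)
    qed
    define N where "N = inner m m"
    have "N \<ge> 0" by (simp add: N_def)
    \<comment> \<open>This \<open>t\<close> makes the polynomial negative unless
      \<open>D = 0\<close>; the summand 1 keeps the denominator positive when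
      \<open>m = 0\<close>.\<close>
    define t where "t = - D / (N + 1)"
    have t: "t * (N + 1) = - D" using \<open>N \<ge> 0\<close> by (simp add: t_def)
    have "0 \<le> (2 * t * D + t\<^sup>2 * N) * (N + 1)\<^sup>2"
      using var[of t] by (intro mult_nonneg_nonneg) (simp_all add: N_def)
    also have "\<dots> = 2 * (t * (N + 1)) * D * (N + 1) + (t * (N + 1))\<^sup>2 * N" by algebra
    also have "\<dots> = - (D\<^sup>2 * (N + 2))" unfolding t by algebra
    finally have "D\<^sup>2 * (N + 2) \<le> 0" by simp
    then have "D = 0" using \<open>N \<ge> 0\<close> by (simp add: mult_le_0_iff)
    then show ?thesis by (simp add: D_def)
  qed
  ultimately show ?thesis by blast
qed

text \<open>A diagonal subsequence makes the inner products with every \<open>x n\<close> converge,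
  hence those with every vector of the span. The limit functional is represented by some
  \<open>p\<close>. An arbitrary vector is then replaced by its projection onto the closed span,
  which is approximated from the span with the help of the norm bound.\<close>

lemma bounded_imp_weakly_convergent_subseq:
  fixes x :: "nat \<Rightarrow> 'a::{real_inner, complete_space}"
  assumes "bounded (range x)"
  shows "\<exists>l r. strict_mono (r :: nat \<Rightarrow> nat) \<and> weakly_converges (x \<circ> r) l"
proof -
  obtain C where C: "\<And>k. norm (x k) \<le> C"
    using assms by (auto simp: bounded_iff)
  have "C \<ge> 0" using C[of 0] norm_ge_zero order_trans by blast
  have inner_le: "\<bar>inner (x k) m\<bar> \<le> C * norm m" for k m
    using Cauchy_Schwarz_ineq2[of "x k" m] mult_right_mono[OF C norm_ge_zero] order_trans by blast
  interpret subseqs "\<lambda>n s. convergent (\<lambda>k. inner (x (s k)) (x n))"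
  proof
    fix n and s :: "nat \<Rightarrow> nat"
    have "bounded (range (\<lambda>k. inner (x (s k)) (x n)))"
      using inner_le by (auto simp: bounded_iff)
    then obtain l r where "strict_mono r" "((\<lambda>k. inner (x (s k)) (x n)) \<circ> r) \<longlonglongrightarrow> l"
      using bounded_imp_convergent_subsequence by blast
    then show "\<exists>r'. strict_mono r' \<and> convergent (\<lambda>k. inner (x ((s \<circ> r') k)) (x n))"
      by (auto simp: convergent_def o_def)
  qed
  define r where "r = diagseq"
  have r: "strict_mono r" unfolding r_def by (rule subseq_diagseq)
  have conv_x: "convergent (\<lambda>k. inner (x (r k)) (x n))" for n
  proof -
    \<comment> \<open>The diagonal is a subsequence of the stage that settles \<open>x n\<close>
      only from index \<open>Suc n\<close> on, so the shift is carried along and removed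
      afterwards.\<close>
    have "convergent (\<lambda>k. inner (x ((diagseq \<circ> ((+) (Suc n))) k)) (x n))"
    proof (rule diagseq_holds)
      fix q s :: "nat \<Rightarrow> nat" and n
      assume "strict_mono q" and "convergent (\<lambda>k. inner (x (s k)) (x n))"
      from convergent_subseq_convergent[OF this(2,1)]
      show "convergent (\<lambda>k. inner (x ((s \<circ> q) k)) (x n))" by (simp add: o_def)
    qed
    then have "convergent (\<lambda>k. inner (x (r (k + Suc n))) (x n))"
      by (simp add: r_def add.commute)
    then show ?thesis 
      using convergent_ignore_initial_segment[of "\<lambda>k. inner (x (r k)) (x n)" "Suc n"] by simp
  qed
  define M where "M = span (range x)"
  have conv: "convergent (\<lambda>k. inner (x (r k)) m)" if "m \<in> M" for m
  proof -
    have "span (range x) \<subseteq> {m. convergent (\<lambda>k. inner (x (r k)) m)}"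
      by (rule span_minimal)
        (auto simp: conv_x subspace_def inner_add_right convergent_const
          intro: convergent_add convergent_mult)
    then show ?thesis using that by (auto simp: M_def)
  qed
  define L where "L m = lim (\<lambda>k. inner (x (r k)) m)" for m
  have L: "(\<lambda>k. inner (x (r k)) m) \<longlonglongrightarrow> L m" if "m \<in> M" for m
    using conv[OF that] by (simp add: L_def convergent_LIMSEQ_iff)
  have subM: "subspace M" by (simp add: M_def)
  have "\<exists>p\<in>closure M. \<forall>m\<in>M. L m = inner p m"
  proof (rule riesz_on_subspace[OF subM])
    show "L (a + b) = L a + L b" if "a \<in> M" "b \<in> M" for a b
      using LIMSEQ_unique[OF L[OF subspace_add[OF subM that]]] tendsto_add[OF L[OF that(1)] L[OF that(2)]]
      by (simp add: inner_add_right)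
    show "L (c *\<^sub>R a) = c * L a" if "a \<in> M" for a c
      using LIMSEQ_unique[OF L[OF subspace_scale[OF subM that]]] tendsto_mult_left[OF L[OF that]]
      by simp
    show "\<bar>L a\<bar> \<le> C * norm a" if "a \<in> M" for a
      by (rule LIMSEQ_le_const2[OF tendsto_rabs[OF L[OF that]]]) (use inner_le in blast)
  qed
  then obtain p where p: "p \<in> closure M" "\<And>m. m \<in> M \<Longrightarrow> L m = inner p m" by blast
  have "(\<lambda>k. inner (x (r k)) h) \<longlonglongrightarrow> inner p h" for h
  proof -
    \<comment> \<open>\<open>q\<close> is the projection of \<open>h\<close>: the difference
      \<open>h - q\<close> is orthogonal to \<open>M\<close> and, by continuity, to its closure. So
      \<open>q\<close> may stand for \<open>h\<close> against \<open>p\<close> and against each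
      \<open>x (r k)\<close>.\<close>
    have "\<exists>q\<in>closure M. \<forall>m\<in>M. inner h m = inner q m"
      by (rule riesz_on_subspace[OF subM, where C = "norm h"])
        (auto simp: inner_add_right Cauchy_Schwarz_ineq2)
    then obtain q where q: "q \<in> closure M" and hq: "\<And>m. m \<in> M \<Longrightarrow> inner h m = inner q m" by blast
    have "closure M \<subseteq> {m. inner m h = inner m q}"
      by (rule closure_minimal)
        (auto simp: inner_commute[of _ h] inner_commute[of _ q] hq
          intro!: closed_Collect_eq continuous_intros)
    then have ph: "inner p h = inner p q" using p(1) by blast
    have "x (r k) \<in> M" for k unfolding M_def by (rule span_base) simp
    then have xh: "inner (x (r k)) h = inner (x (r k)) q" for k
      by (metis hq inner_commute)
    have "(\<lambda>k. inner (x (r k)) q) \<longlonglongrightarrow> inner p q"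
    proof (rule LIMSEQ_I)
      fix e :: real assume e: "e > 0"
      \<comment> \<open>A bound for the norms of \<open>x (r k) - p\<close>, made positive by the
        summand 1 so that it can be divided by.\<close>
      define K where "K = C + norm p + 1"
      have K: "K > 0" using \<open>C \<ge> 0\<close> by (simp add: K_def add_nonneg_pos)
      obtain m where m: "m \<in> M" "dist m q < e / (2 * K)"
        using q e K unfolding closure_approachable by (meson divide_pos_pos mult_pos_pos zero_less_numeral)
      obtain N where N: "\<And>k. k \<ge> N \<Longrightarrow> norm (inner (x (r k)) m - inner p m) < e / 2"
        using LIMSEQ_D[OF L[OF m(1)], of "e / 2"] e p(2)[OF m(1)] by auto
      have "norm (inner (x (r k)) q - inner p q) < e" if "k \<ge> N" for k
      proof -
        have "inner (x (r k)) q - inner p q =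
            (inner (x (r k)) m - inner p m) + inner (x (r k) - p) (q - m)"
          by (simp add: inner_diff algebra_simps)
        moreover have "\<bar>inner (x (r k) - p) (q - m)\<bar> \<le> K * dist m q"
        proof -
          have "norm (x (r k) - p) \<le> K"
            using norm_triangle_ineq4[of "x (r k)" p] C[of "r k"] by (simp add: K_def)
          then show ?thesis
            using Cauchy_Schwarz_ineq2[of "x (r k) - p" "q - m"]
              mult_right_mono[of "norm (x (r k) - p)" K "norm (q - m)"]
            by (simp add: dist_norm norm_minus_commute)
        qed
        moreover have "K * dist m q < e / 2" using m(2) K by (simp add: field_simps)
        ultimately show ?thesis using N[OF that] unfolding real_norm_def by linarith
      qed
      then show "\<exists>no. \<forall>k\<ge>no. norm (inner (x (r k)) q - inner p q) < e" by blast
    qed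
    then show ?thesis by (simp add: ph xh)
  qed
  then show ?thesis using r by (auto simp: weakly_converges_def)
qed

lemma weakly_converges_subseq:
  assumes "weakly_converges x l" and "strict_mono r"
  shows "weakly_converges (x \<circ> r) l"
  unfolding weakly_converges_def
proof
  fix w
  have "(\<lambda>k. inner (x k) w) \<longlonglongrightarrow> inner l w"
    using assms(1) by (simp add: weakly_converges_def)
  from LIMSEQ_subseq_LIMSEQ[OF this assms(2)]
  show "(\<lambda>k. inner ((x \<circ> r) k) w) \<longlonglongrightarrow> inner l w" by (simp add: o_def)
qed

text \<open>If convergence failed against some \<open>w\<close>, infinitely many terms would keep a
  distance \<open>e\<close> from the limit there. By boundedness these have a weakly convergent
  subsequence, whose limit must be \<open>l\<close>, a contradiction.\<close>

lemma weakly_convergesI_subseq: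
  fixes x :: "nat \<Rightarrow> 'a::{real_inner, complete_space}"
  assumes bdd: "bounded (range x)"
    and uniq: "\<And>r a. strict_mono r \<Longrightarrow> weakly_converges (x \<circ> r) a \<Longrightarrow> a = l"
  shows "weakly_converges x l"
proof (rule ccontr)
  assume "\<not> weakly_converges x l"
  then obtain w where "\<not> (\<lambda>k. inner (x k) w) \<longlonglongrightarrow> inner l w"
    unfolding weakly_converges_def by blast
  then obtain e where e: "e > 0" "\<And>N. \<exists>k\<ge>N. dist (inner (x k) w) (inner l w) \<ge> e"
    unfolding lim_sequentially by (meson not_le)
  define S where "S = {k. dist (inner (x k) w) (inner l w) \<ge> e}"
  have "infinite S"
    unfolding infinite_nat_iff_unbounded_le S_def using e(2) by blast
  then obtain r :: "nat \<Rightarrow> nat" where r: "strict_mono r" "\<And>n. r n \<in> S"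
    using infinite_enumerate by blast
  have "bounded (range (x \<circ> r))"
    by (rule bounded_subset[OF bdd]) auto
  then obtain a s where s: "strict_mono s" "weakly_converges ((x \<circ> r) \<circ> s) a"
    using bounded_imp_weakly_convergent_subseq by blast
  then have "a = l"
    using uniq[of "r \<circ> s"] r(1) by (simp add: o_assoc strict_mono_o)
  then have "(\<lambda>k. inner (x (r (s k))) w) \<longlonglongrightarrow> inner l w"
    using s(2) by (simp add: weakly_converges_def)
  then obtain k where "dist (inner (x (r (s k))) w) (inner l w) < e"
    unfolding lim_sequentially using e(1) by blast
  then show False using r(2)[of "s k"] by (simp add: S_def)
qed

text \<open>For weak cluster points \<open>l\<close> and \<open>a\<close>, both in \<open>S\<close>,
  polarization expresses \<open>inner (x k) (l - a)\<close> through the distances to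
  \<open>a\<close> and \<open>l\<close>, which converge by monotonicity. The inner products thus
  converge along the whole sequence, and evaluating the limit along both subsequences gives
  \<open>inner (l - a) (l - a) = 0\<close>.\<close>

lemma opial:
  fixes x :: "nat \<Rightarrow> 'a::{real_inner, complete_space}"
  assumes ne: "S \<noteq> {}"
    and fejer: "\<And>s k. s \<in> S \<Longrightarrow> norm (x (Suc k) - s) \<le> norm (x k - s)"
    and cluster: "\<And>r a. strict_mono r \<Longrightarrow> weakly_converges (x \<circ> r) a \<Longrightarrow> a \<in> S"
  shows "\<exists>l\<in>S. weakly_converges x l"
proof -
  have dec: "decseq (\<lambda>k. norm (x k - s))" if "s \<in> S" for s
    using fejer[OF that] by (rule decseq_SucI)
  have conv: "convergent (\<lambda>k. norm (x k - s))" if "s \<in> S" for s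
    using decseq_convergent[OF dec[OF that], of 0] by (auto simp: convergent_def)
  obtain s where s: "s \<in> S" using ne by blast
  have "norm (x k) \<le> norm (x 0 - s) + norm s" for k
    using decseqD[OF dec[OF s], of 0 k] norm_triangle_sub[of "x k" s] by linarith
  then have bdd: "bounded (range x)" by (auto simp: bounded_iff)
  obtain l r where r: "strict_mono r" "weakly_converges (x \<circ> r) l"
    using bounded_imp_weakly_convergent_subseq[OF bdd] by blast
  have l: "l \<in> S" using cluster r by blast
  have "a = l" if q: "strict_mono q" "weakly_converges (x \<circ> q) a" for q a
  proof -
    have a: "a \<in> S" using cluster q by blast
    have polar: "inner (x k) (l - a) =
        ((norm (x k - a))\<^sup>2 - (norm (x k - l))\<^sup>2 + (norm l)\<^sup>2 - (norm a)\<^sup>2) / 2" for k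
      by (simp add: power2_norm_eq_inner inner_diff inner_commute)
    obtain ca cl where "(\<lambda>k. norm (x k - a)) \<longlonglongrightarrow> ca" "(\<lambda>k. norm (x k - l)) \<longlonglongrightarrow> cl"
      using conv[OF a] conv[OF l] by (auto simp: convergent_def)
    then have lim: "(\<lambda>k. inner (x k) (l - a)) \<longlonglongrightarrow> (ca\<^sup>2 - cl\<^sup>2 + (norm l)\<^sup>2 - (norm a)\<^sup>2) / 2"
      unfolding polar by (intro tendsto_intros) auto
    have "inner b (l - a) = (ca\<^sup>2 - cl\<^sup>2 + (norm l)\<^sup>2 - (norm a)\<^sup>2) / 2"
      if "strict_mono p" "weakly_converges (x \<circ> p) b" for p b
      using LIMSEQ_unique[OF LIMSEQ_subseq_LIMSEQ[OF lim that(1)], of "inner b (l - a)"] that(2)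
      by (simp add: weakly_converges_def o_def)
    then have "inner l (l - a) = inner a (l - a)" using r q by metis
    then have "inner (l - a) (l - a) = 0" by (simp add: inner_diff_left)
    then show ?thesis by simp
  qed
  then have "weakly_converges x l"
    by (intro weakly_convergesI_subseq[OF bdd]) blast
  then show ?thesis using l by blast
qed

section \<open>Maximal comonotone operators and weak limits in their graphs\<close>

lemma comonotoneD:
  assumes "comonotone \<sigma> A" and "u \<in> A x" and "v \<in> A y"
  shows "\<sigma> * (norm (u - v))\<^sup>2 \<le> inner (x - y) (u - v)"
proof -
  have "(x, u) \<in> gra A" "(y, v) \<in> gra A" using assms(2,3) by (simp_all add: gra_def)
  then show ?thesis using assms(1) unfolding comonotone_def by blast
qed

text \<open>Otherwise adding \<open>(p, u)\<close> to the graph would give a proper comonotone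
  extension: the assumed inequality makes the new pair compatible with every old one, and it is
  symmetric in the two pairs.\<close>

lemma maximal_comonotoneD:
  assumes max: "maximal_comonotone \<sigma> A"
    and rel: "\<And>a s. s \<in> A a \<Longrightarrow> \<sigma> * (norm (u - s))\<^sup>2 \<le> inner (p - a) (u - s)"
  shows "u \<in> A p"
proof (rule ccontr)
  assume no: "u \<notin> A p"
  define C where "C = A(p := insert u (A p))"
  have graC: "gra C = insert (p, u) (gra A)" by (auto simp: gra_def C_def split: if_splits)
  have mono: "comonotone \<sigma> A" using max by (simp add: maximal_comonotone_def)
  have rel': "\<sigma> * (norm (s - u))\<^sup>2 \<le> inner (a - p) (s - u)" if "s \<in> A a" for a s
    using rel[OF that] inner_minus_left[of "p - a" "s - u"] inner_minus_right[of "p - a" "u - s"]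
    by (simp add: norm_minus_commute)
  have "comonotone \<sigma> C"
    unfolding comonotone_def graC
    using mono rel rel' by (auto simp: gra_def dest: comonotoneD)
  moreover have "gra A \<subset> gra C" using no unfolding graC by (auto simp: gra_def)
  ultimately show False using max unfolding maximal_comonotone_def by blast
qed

text \<open>The infimum of the slack over the graph is at most 0: a uniform slack \<open>c\<close>
  would put \<open>(p, u)\<close> into the graph by maximality, and testing that pair against itself
  gives slack 0.\<close>

lemma maximal_comonotone_not_strictly_related:
  assumes max: "maximal_comonotone \<sigma> A" and c: "c > 0"
  shows "\<exists>a s. s \<in> A a \<and> inner (p - a) (u - s) - \<sigma> * (norm (u - s))\<^sup>2 < c"
proof (rule ccontr)
  assume "\<not> ?thesis"
  then have le: "c \<le> inner (p - a) (u - s) - \<sigma> * (norm (u - s))\<^sup>2" if "s \<in> A a" for a s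
    using that by force
  have "u \<in> A p" by (rule maximal_comonotoneD[OF max]) (use le c in force)
  then show False using le[of u p] c by simp
qed

text \<open>
  The infima over the two graphs are each at most 0 by maximality and add up to at least 0, so
  both vanish.
\<close>
lemma maximal_comonotone_pair:
  assumes A: "maximal_comonotone \<alpha> A" and B: "maximal_comonotone \<beta> B"
    and rel: "\<And>a s b t. s \<in> A a \<Longrightarrow> t \<in> B b \<Longrightarrow>
        \<alpha> * (norm (u - s))\<^sup>2 + \<beta> * (norm (v - t))\<^sup>2 \<le> inner (p - a) (u - s) + inner (q - b) (v - t)"
  shows "u \<in> A p \<and> v \<in> B q"
proof
  show "u \<in> A p"
  proof (rule maximal_comonotoneD[OF A], rule ccontr)
    fix a s assume s: "s \<in> A a" and neg: "\<not> \<alpha> * (norm (u - s))\<^sup>2 \<le> inner (p - a) (u - s)"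
    \<comment> \<open>The deficit of the \<open>A\<close> inequality at \<open>(a, s)\<close> is the
      constant for the preceding lemma: some pair in the graph of \<open>B\<close> has a smaller
      slack, against \<open>rel\<close>.\<close>
    then show False
      using maximal_comonotone_not_strictly_related[OF B, of "\<alpha> * (norm (u - s))\<^sup>2 - inner (p - a) (u - s)" q v]
        rel[OF s] by force
  qed
  show "v \<in> B q"
  proof (rule maximal_comonotoneD[OF B], rule ccontr)
    fix b t assume t: "t \<in> B b" and neg: "\<not> \<beta> * (norm (v - t))\<^sup>2 \<le> inner (q - b) (v - t)"
    then show False
      using maximal_comonotone_not_strictly_related[OF A, of "\<beta> * (norm (v - t))\<^sup>2 - inner (q - b) (v - t)" p u]
        rel[OF _ t] by force
  qed
qed

lemma tendsto_inner_bounded_null: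
  fixes f g :: "nat \<Rightarrow> 'a::real_inner"
  assumes "bounded (range f)" and "g \<longlonglongrightarrow> 0"
  shows "(\<lambda>k. inner (f k) (g k)) \<longlonglongrightarrow> 0"
proof -
  have "Bfun f sequentially"
    using assms(1) by (simp add: Bseq_eq_bounded)
  then show ?thesis
    using bounded_bilinear.Bfun_prod_Zfun[OF bounded_bilinear_inner] assms(2)
    by (simp add: tendsto_Zfun_iff)
qed

text \<open>
  Neither product \<open>\<langle>y\<^sub>k, u\<^sub>k\<rangle>\<close>, \<open>\<langle>z\<^sub>k, v\<^sub>k\<rangle>\<close> need converge, but their sum tends to 0, and the quadratic
  terms add up to \<open>(\<alpha> + \<beta>) \<parallel>u\<^sub>k\<parallel>\<^sup>2\<close>, which is weakly lower semicontinuous.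
\<close>
lemma weak_limit_in_graphs:
  fixes A B :: "'a::real_inner operator"
  assumes A: "maximal_comonotone \<alpha> A" and B: "maximal_comonotone \<beta> B"
    and ab: "\<alpha> + \<beta> \<ge> 0"
    and u: "\<And>k. u k \<in> A (y k)" and v: "\<And>k. v k \<in> B (z k)"
    and bdd: "bounded (range u)" "bounded (range y)"
    and yp: "weakly_converges y p" and uq: "weakly_converges u q"
    and d: "(\<lambda>k. z k - y k) \<longlonglongrightarrow> 0" and e: "(\<lambda>k. u k + v k) \<longlonglongrightarrow> 0"
  shows "q \<in> A p \<and> - q \<in> B p"
proof (rule maximal_comonotone_pair[OF A B])
  fix a s b t assume s: "s \<in> A a" and t: "t \<in> B b"
  define D where "D k = z k - y k" for k
  define E where "E k = u k + v k" for k
  have D: "D \<longlonglongrightarrow> 0" and E: "E \<longlonglongrightarrow> 0" using d e by (simp_all add: D_def[abs_def] E_def[abs_def])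
  have null: "(\<lambda>k. inner (u k) (D k)) \<longlonglongrightarrow> 0" "(\<lambda>k. inner (u k) (E k)) \<longlonglongrightarrow> 0"
      "(\<lambda>k. inner (y k) (E k)) \<longlonglongrightarrow> 0"
    using tendsto_inner_bounded_null bdd D E by blast+
  have ulim: "(\<lambda>k. inner (u k) w) \<longlonglongrightarrow> inner q w" and ylim: "(\<lambda>k. inner (y k) w) \<longlonglongrightarrow> inner p w" for w
    using yp uq by (auto simp: weakly_converges_def)
  \<comment> \<open>\<open>l k\<close> is the quadratic side minus
    \<open>(\<alpha> + \<beta>) * (norm (u k - q))\<^sup>2\<close>, which leaves terms affine in
    \<open>u k\<close> and null terms. In \<open>r k\<close> the substitution
    \<open>z = y + D\<close>, \<open>v = E - u\<close> cancels \<open>inner (y k) (u k)\<close>, the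
    product without a known limit.\<close>
  define l where "l k = (\<alpha> + \<beta>) * (2 * inner (u k) q - inner q q) - 2 * \<alpha> * inner (u k) s
      + \<alpha> * inner s s + 2 * \<beta> * inner (u k) t + \<beta> * inner t t
      + \<beta> * (inner (E k) (E k) - 2 * (inner (u k) (E k) + inner (E k) t))" for k
  define r where "r k = inner (u k) (b - a) - inner (y k) (s + t) + inner a s + inner b t
      + (inner (y k) (E k) + inner (D k) (E k) - inner (u k) (D k) - inner (D k) t - inner (E k) b)" for k
  have "l k \<le> r k" for k
  proof -
    have "\<alpha> * (norm (u k - s))\<^sup>2 + \<beta> * (norm (v k - t))\<^sup>2 \<le> inner (y k - a) (u k - s) + inner (z k - b) (v k - t)"
      using comonotoneD[OF _ u[of k] s] comonotoneD[OF _ v[of k] t] A B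
      unfolding maximal_comonotone_def by (meson add_mono)
    moreover have "inner (y k - a) (u k - s) + inner (z k - b) (v k - t) = r k"
      by (simp add: r_def D_def E_def inner_add inner_diff inner_commute algebra_simps)
    moreover have "\<alpha> * (norm (u k - s))\<^sup>2 + \<beta> * (norm (v k - t))\<^sup>2 =
        l k + (\<alpha> + \<beta>) * (norm (u k - q))\<^sup>2"
      by (simp add: l_def E_def power2_norm_eq_inner inner_add inner_diff inner_commute algebra_simps)
    moreover have "0 \<le> (\<alpha> + \<beta>) * (norm (u k - q))\<^sup>2" using ab by simp
    ultimately show ?thesis by linarith
  qed
  moreover have "l \<longlonglongrightarrow> (\<alpha> + \<beta>) * (2 * inner q q - inner q q) - 2 * \<alpha> * inner q s
      + \<alpha> * inner s s + 2 * \<beta> * inner q t + \<beta> * inner t t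
      + \<beta> * (inner 0 (0::'a) - 2 * (0 + inner 0 t))"
    unfolding l_def[abs_def] by (intro tendsto_intros ulim E null)
  moreover have "r \<longlonglongrightarrow> inner q (b - a) - inner p (s + t) + inner a s + inner b t
      + (0 + inner 0 (0::'a) - 0 - inner 0 t - inner 0 b)"
    unfolding r_def[abs_def] by (intro tendsto_intros ulim ylim D E null)
  ultimately have "(\<alpha> + \<beta>) * inner q q - 2 * \<alpha> * inner q s + \<alpha> * inner s s + 2 * \<beta> * inner q t + \<beta> * inner t t
      \<le> inner q (b - a) - inner p (s + t) + inner a s + inner b t"
    using LIMSEQ_le[of l "(\<alpha> + \<beta>) * inner q q - 2 * \<alpha> * inner q s + \<alpha> * inner s s + 2 * \<beta> * inner q t + \<beta> * inner t t"
        r "inner q (b - a) - inner p (s + t) + inner a s + inner b t"]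
    by simp
  then show "\<alpha> * (norm (q - s))\<^sup>2 + \<beta> * (norm (- q - t))\<^sup>2 \<le> inner (p - a) (q - s) + inner (p - b) (- q - t)"
    by (simp add: power2_norm_eq_inner inner_add inner_diff inner_commute algebra_simps)
qed

section \<open>Resolvents, zeros and fixed points\<close>

lemma mem_resolvent_iff:
  assumes "\<gamma> > 0"
  shows "y \<in> resolvent \<gamma> A x \<longleftrightarrow> (1 / \<gamma>) *\<^sub>R (x - y) \<in> A y"
proof
  assume "y \<in> resolvent \<gamma> A x"
  then obtain u where "u \<in> A y" "x = y + \<gamma> *\<^sub>R u"
    by (auto simp: resolvent_def op_inverse_def op_add_def op_id_def op_scale_def)
  then show "(1 / \<gamma>) *\<^sub>R (x - y) \<in> A y" using assms by simp
next
  assume "(1 / \<gamma>) *\<^sub>R (x - y) \<in> A y"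
  moreover have "x = y + \<gamma> *\<^sub>R ((1 / \<gamma>) *\<^sub>R (x - y))" using assms by simp
  ultimately show "y \<in> resolvent \<gamma> A x"
    unfolding resolvent_def op_inverse_def op_add_def op_id_def op_scale_def by blast
qed

text \<open>The Yosida approximation is Lipschitz with constant
  \<open>1 / (\<gamma> + \<alpha>)\<close>: comonotonicity bounds the inner product of the resolvent
  arguments' difference with \<open>u - v\<close> from below by
  \<open>(\<gamma> + \<alpha>) * (norm (u - v))\<^sup>2\<close>, and Cauchy-Schwarz bounds it from
  above.\<close>

lemma yosida_slope_bound:
  assumes "comonotone \<alpha> A" and "\<gamma> + \<alpha> > 0" and "u \<in> A y" and "v \<in> A z"
  shows "norm (u - v) \<le> norm ((y + \<gamma> *\<^sub>R u) - (z + \<gamma> *\<^sub>R v)) / (\<gamma> + \<alpha>)"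
proof -
  let ?d = "(y + \<gamma> *\<^sub>R u) - (z + \<gamma> *\<^sub>R v)"
  have "(\<gamma> + \<alpha>) * (norm (u - v))\<^sup>2 \<le> inner (y - z) (u - v) + \<gamma> * (norm (u - v))\<^sup>2"
    using comonotoneD[OF assms(1,3,4)] by (simp add: algebra_simps)
  also have "\<dots> = inner ?d (u - v)"
    by (simp add: power2_norm_eq_inner inner_add inner_diff inner_commute algebra_simps)
  also have "\<dots> \<le> norm ?d * norm (u - v)" by (rule norm_cauchy_schwarz)
  finally have "(\<gamma> + \<alpha>) * norm (u - v) * norm (u - v) \<le> norm ?d * norm (u - v)"
    by (simp add: power2_eq_square mult.assoc)
  then have "(\<gamma> + \<alpha>) * norm (u - v) \<le> norm ?d"
    by (cases "norm (u - v) = 0") (auto simp: mult_le_cancel_right)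
  then show ?thesis using assms(2) by (simp add: field_simps)
qed

text \<open>The resolvent is the identity minus \<open>\<gamma>\<close> times the Yosida
  approximation. This constant suffices both for single-valuedness and for carrying the rate from
  \<open>x\<close> over to \<open>y\<close>.\<close>

lemma resolvent_lipschitz:
  assumes "comonotone \<alpha> A" and "\<gamma> > 0" and "\<gamma> + \<alpha> > 0"
    and "y \<in> resolvent \<gamma> A x" and "y' \<in> resolvent \<gamma> A x'"
  shows "norm (y - y') \<le> (1 + \<gamma> / (\<gamma> + \<alpha>)) * norm (x - x')"
proof -
  let ?u = "(1 / \<gamma>) *\<^sub>R (x - y)" and ?u' = "(1 / \<gamma>) *\<^sub>R (x' - y')"
  have "?u \<in> A y" "?u' \<in> A y'" using assms by (simp_all add: mem_resolvent_iff)
  from yosida_slope_bound[OF assms(1,3) this] assms(2)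
  have le: "norm (?u - ?u') \<le> norm (x - x') / (\<gamma> + \<alpha>)" by simp
  have "y - y' = (x - x') - \<gamma> *\<^sub>R (?u - ?u')" using assms(2) by (simp add: algebra_simps)
  then have "norm (y - y') \<le> norm (x - x') + \<gamma> * norm (?u - ?u')"
    using norm_triangle_ineq4[of "x - x'" "\<gamma> *\<^sub>R (?u - ?u')"] assms(2) by simp
  then show ?thesis
    using mult_left_mono[OF le, of \<gamma>] assms(2) by (simp add: algebra_simps)
qed

lemma resolvent_singleton:
  assumes "comonotone \<alpha> A" and "\<gamma> > 0" and "\<gamma> + \<alpha> > 0" and "p \<in> resolvent \<gamma> A x"
  shows "resolvent \<gamma> A x = {p}"
proof -
  have "q = p" if "q \<in> resolvent \<gamma> A x" for q
    using resolvent_lipschitz[OF assms(1-3) that assms(4)] by simp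
  then show ?thesis using assms(4) by blast
qed

lemma zer_op_add_iff: "p \<in> zer (op_add A B) \<longleftrightarrow> (\<exists>u. u \<in> A p \<and> - u \<in> B p)"
  for p :: "'a::real_vector"
proof
  assume "p \<in> zer (op_add A B)"
  then obtain u v where "u \<in> A p" "v \<in> B p" "0 = u + v" by (auto simp: zer_def op_add_def)
  moreover from this have "v = - u" by (simp add: eq_neg_iff_add_eq_0 add.commute)
  ultimately show "\<exists>u. u \<in> A p \<and> - u \<in> B p" by blast
next
  assume "\<exists>u. u \<in> A p \<and> - u \<in> B p"
  then obtain u where "u \<in> A p" "- u \<in> B p" by blast
  moreover have "0 = u + - u" by simp
  ultimately show "p \<in> zer (op_add A B)" unfolding zer_def op_add_def by blast
qed

text \<open>The relation between \<open>lam\<close> and \<open>\<mu>\<close> collapses the two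
  relaxations to \<open>x + \<mu> *\<^sub>R (z - y)\<close>, so \<open>x\<close> is fixed exactly
  when \<open>z = y\<close>. The two resolvent conditions then concern the single point
  \<open>y\<close>.\<close>

lemma mem_Fix_adaptive_DR_iff:
  fixes A B :: "'a::real_vector operator"
  assumes "\<gamma> > 0" and "\<delta> > 0" and "lam > 1" and "\<mu> > 1"
    and lm: "(lam - 1) * (\<mu> - 1) = 1" and \<delta>: "\<delta> = \<gamma> * (lam - 1)" and "\<kappa> > 0"
  shows "x \<in> Fix (adaptive_DR \<gamma> \<delta> lam \<mu> \<kappa> A B) \<longleftrightarrow>
      (\<exists>p u. u \<in> A p \<and> - u \<in> B p \<and> x = p + \<gamma> *\<^sub>R u)"
proof -
  have mem: "x \<in> Fix (adaptive_DR \<gamma> \<delta> lam \<mu> \<kappa> A B) \<longleftrightarrow>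
      (\<exists>y z. y \<in> resolvent \<gamma> A x \<and> z \<in> resolvent \<delta> B (lam *\<^sub>R y + (1 - lam) *\<^sub>R x) \<and>
        x = (1 - \<kappa>) *\<^sub>R x + \<kappa> *\<^sub>R (\<mu> *\<^sub>R z + (1 - \<mu>) *\<^sub>R (lam *\<^sub>R y + (1 - lam) *\<^sub>R x)))"
    unfolding Fix_def adaptive_DR_def relaxed_resolvent_def op_add_def op_scale_def op_comp_def op_id_def
    by auto blast+
  have "(1 - \<mu>) * (1 - lam) = 1" "(1 - \<mu>) * lam = - \<mu>"
    using lm by (auto simp: algebra_simps)
  then have relax: "\<mu> *\<^sub>R z + (1 - \<mu>) *\<^sub>R (lam *\<^sub>R y + (1 - lam) *\<^sub>R x) = x + \<mu> *\<^sub>R (z - y)" for y z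
    by (simp add: scaleR_add_right scaleR_diff_right)
  have eq: "x = (1 - \<kappa>) *\<^sub>R x + \<kappa> *\<^sub>R (x + \<mu> *\<^sub>R (z - y)) \<longleftrightarrow> z = y" for y z
  proof -
    have "(1 - \<kappa>) *\<^sub>R x + \<kappa> *\<^sub>R (x + \<mu> *\<^sub>R (z - y)) = x + (\<kappa> * \<mu>) *\<^sub>R (z - y)"
      by (simp add: algebra_simps)
    then show ?thesis using \<open>\<kappa> > 0\<close> \<open>\<mu> > 1\<close> by simp
  qed
  have refl: "lam *\<^sub>R y + (1 - lam) *\<^sub>R x - y = - ((lam - 1) *\<^sub>R (x - y))" for y
    by (simp add: algebra_simps)
  \<comment> \<open>Here \<open>\<delta> = \<gamma> * (lam - 1)\<close> enters: it makes the element
    of \<open>B y\<close> exactly the negative of the element of \<open>A y\<close>.\<close>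
  have "(1 / \<delta>) *\<^sub>R (lam *\<^sub>R y + (1 - lam) *\<^sub>R x - y) = - ((1 / \<gamma>) *\<^sub>R (x - y))" for y
  proof -
    have "(lam - 1) / \<delta> = 1 / \<gamma>" using \<delta> \<open>\<delta> > 0\<close> \<open>\<gamma> > 0\<close> by (simp add: field_simps)
    then show ?thesis by (simp add: refl)
  qed
  then have "x \<in> Fix (adaptive_DR \<gamma> \<delta> lam \<mu> \<kappa> A B) \<longleftrightarrow>
      (\<exists>y. (1 / \<gamma>) *\<^sub>R (x - y) \<in> A y \<and> - ((1 / \<gamma>) *\<^sub>R (x - y)) \<in> B y)"
    unfolding mem relax eq by (simp add: mem_resolvent_iff \<open>\<gamma> > 0\<close> \<open>\<delta> > 0\<close>)
  also have "\<dots> \<longleftrightarrow> (\<exists>p u. u \<in> A p \<and> - u \<in> B p \<and> x = p + \<gamma> *\<^sub>R u)"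
  proof
    assume "\<exists>y. (1 / \<gamma>) *\<^sub>R (x - y) \<in> A y \<and> - ((1 / \<gamma>) *\<^sub>R (x - y)) \<in> B y"
    then obtain y where "(1 / \<gamma>) *\<^sub>R (x - y) \<in> A y" "- ((1 / \<gamma>) *\<^sub>R (x - y)) \<in> B y" by blast
    moreover have "x = y + \<gamma> *\<^sub>R ((1 / \<gamma>) *\<^sub>R (x - y))" using \<open>\<gamma> > 0\<close> by simp
    ultimately show "\<exists>p u. u \<in> A p \<and> - u \<in> B p \<and> x = p + \<gamma> *\<^sub>R u" by blast
  next
    assume "\<exists>p u. u \<in> A p \<and> - u \<in> B p \<and> x = p + \<gamma> *\<^sub>R u"
    then obtain p u where "u \<in> A p" "- u \<in> B p" "x = p + \<gamma> *\<^sub>R u" by blast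
    moreover from this have "(1 / \<gamma>) *\<^sub>R (x - p) = u" using \<open>\<gamma> > 0\<close> by simp
    ultimately show "\<exists>y. (1 / \<gamma>) *\<^sub>R (x - y) \<in> A y \<and> - ((1 / \<gamma>) *\<^sub>R (x - y)) \<in> B y"
      by metis
  qed
  finally show ?thesis .
qed

section \<open>Completing the square in the comonotonicity inequalities\<close>

text \<open>For \<open>\<alpha> + \<beta> = 0\<close> the last term is \<open>0\<close> by the convention for division by zero.\<close>
lemma quadratic_form_identity:
  fixes u v :: "'a::real_inner"
  assumes "\<alpha> + \<beta> \<ge> 0" and "\<gamma> > 0" and "\<delta> > 0" and "\<alpha> + \<beta> = 0 \<Longrightarrow> \<delta> = \<gamma> + 2 * \<alpha>"
  shows "(\<gamma> + \<alpha>) * (norm u)\<^sup>2 + (\<delta> + \<beta>) * (norm v)\<^sup>2 + (\<gamma> + \<delta>) * inner u v =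
    (\<gamma> + \<delta>) * kappa_star \<alpha> \<beta> \<gamma> \<delta> / 2 * (norm (u + v))\<^sup>2 +
    (norm ((\<gamma> + 2 * \<alpha> - \<delta>) *\<^sub>R u - (\<delta> + 2 * \<beta> - \<gamma>) *\<^sub>R v))\<^sup>2 / (4 * (\<alpha> + \<beta>))"
proof (cases "\<alpha> + \<beta> = 0")
  case True
  then have "\<beta> = - \<alpha>" "\<delta> = \<gamma> + 2 * \<alpha>" using assms(4) by auto
  then show ?thesis
    by (simp add: kappa_star_def power2_norm_eq_inner inner_add inner_commute algebra_simps)
next
  case False
  define \<sigma> where "\<sigma> = \<alpha> + \<beta>"
  have \<sigma>: "\<sigma> \<noteq> 0" and \<beta>: "\<beta> = \<sigma> - \<alpha>" using False by (auto simp: \<sigma>_def)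
  \<comment> \<open>This is the number \<open>c\<close> for which the quadratic form minus
    \<open>c * (norm (u + v))\<^sup>2\<close> has zero determinant and so reduces to a multiple of
    one square; solving for \<open>c\<close> is the origin of \<open>kappa_star\<close>.\<close>
  have ks: "(\<gamma> + \<delta>) * kappa_star \<alpha> \<beta> \<gamma> \<delta> / 2 = (4 * (\<gamma> + \<alpha>) * (\<delta> + \<beta>) - (\<gamma> + \<delta>)\<^sup>2) / (4 * \<sigma>)"
  proof -
    have "(\<gamma> + \<delta>) * (c / (2 * (\<gamma> + \<delta>) * \<sigma>)) / 2 = c / (4 * \<sigma>)" for c
      using assms(2,3) \<sigma> by (simp add: divide_simps)
    then show ?thesis using \<sigma> by (simp only: kappa_star_def \<sigma>_def[symmetric] if_False)
  qed
  have "4 * \<sigma> * ((\<gamma> + \<alpha>) * (norm u)\<^sup>2 + (\<delta> + \<beta>) * (norm v)\<^sup>2 + (\<gamma> + \<delta>) * inner u v) =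
      (4 * (\<gamma> + \<alpha>) * (\<delta> + \<beta>) - (\<gamma> + \<delta>)\<^sup>2) * (norm (u + v))\<^sup>2 +
      (norm ((\<gamma> + 2 * \<alpha> - \<delta>) *\<^sub>R u - (\<delta> + 2 * \<beta> - \<gamma>) *\<^sub>R v))\<^sup>2"
    unfolding power2_norm_eq_inner inner_add inner_diff inner_scaleR_left inner_scaleR_right \<beta>
      inner_commute[of v u]
    by algebra
  then show ?thesis unfolding ks \<sigma>_def[symmetric] using \<sigma> by (simp add: field_simps)
qed

section \<open>Rules for weak limits and square summable sequences\<close>

lemma tendsto_imp_weakly_converges:
  assumes "x \<longlonglongrightarrow> l"
  shows "weakly_converges x l"
  using assms by (auto simp: weakly_converges_def intro!: tendsto_intros)

lemma weakly_converges_add_scaleR: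
  assumes "weakly_converges x a" and "weakly_converges y b"
  shows "weakly_converges (\<lambda>k. x k + c *\<^sub>R y k) (a + c *\<^sub>R b)"
  unfolding weakly_converges_def
proof
  fix w
  have "(\<lambda>k. inner (x k) w + c * inner (y k) w) \<longlonglongrightarrow> inner a w + c * inner b w"
    using assms unfolding weakly_converges_def by (intro tendsto_add tendsto_mult_left) blast+
  then show "(\<lambda>k. inner (x k + c *\<^sub>R y k) w) \<longlonglongrightarrow> inner (a + c *\<^sub>R b) w"
    by (simp add: inner_add_left)
qed

lemma summable_telescoping_bound:
  fixes a b :: "nat \<Rightarrow> real"
  assumes step: "\<And>k. a (Suc k) + b k \<le> a k" and "\<And>k. 0 \<le> a k" and "\<And>k. 0 \<le> b k"
  shows "summable b"
proof (rule summableI_nonneg_bounded)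
  have "(\<Sum>i<n. b i) + a n \<le> a 0" for n
  proof (induction n)
    case (Suc n)
    then show ?case using step[of n] by simp
  qed simp
  then show "(\<Sum>i<n. b i) \<le> a 0" for n
    using assms(2)[of n] by (meson add_increasing2 order_trans order_refl)
qed (rule assms(3))

lemma summable_norm_square_imp_tendsto_0:
  fixes f :: "nat \<Rightarrow> 'a::real_normed_vector"
  assumes "summable (\<lambda>k. (norm (f k))\<^sup>2)"
  shows "f \<longlonglongrightarrow> 0"
proof -
  have "(\<lambda>k. sqrt ((norm (f k))\<^sup>2)) \<longlonglongrightarrow> sqrt 0"
    by (intro tendsto_real_sqrt summable_LIMSEQ_zero assms)
  then show ?thesis by (simp add: tendsto_norm_zero_iff)
qed

section \<open>Descent inequality for one step\<close>

text \<open>Two arbitrary trajectories are compared so that the inequality serves twice: against a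
  fixed point, where \<open>u' + v' = 0\<close>, it gives Fejer monotonicity, and against the next
  iterate it shows that the step norms do not increase.\<close>

lemma adaptive_DR_step:
  fixes A B :: "'a::real_inner operator"
  assumes A: "comonotone \<alpha> A" and B: "comonotone \<beta> B"
    and params: "\<alpha> + \<beta> \<ge> 0" "\<gamma> > 0" "\<delta> > 0" "\<alpha> + \<beta> = 0 \<longrightarrow> \<delta> = \<gamma> + 2 * \<alpha>" "\<kappa> \<ge> 0"
    and u: "u \<in> A y" and v: "v \<in> B (y - \<delta> *\<^sub>R (u + v))"
    and u': "u' \<in> A y'" and v': "v' \<in> B (y' - \<delta> *\<^sub>R (u' + v'))"
  defines "x \<equiv> y + \<gamma> *\<^sub>R u" and "x' \<equiv> y' + \<gamma> *\<^sub>R u'"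
  shows "(norm ((x - (\<kappa> * (\<gamma> + \<delta>)) *\<^sub>R (u + v)) - (x' - (\<kappa> * (\<gamma> + \<delta>)) *\<^sub>R (u' + v'))))\<^sup>2
      + (\<kappa> * (\<gamma> + \<delta>)\<^sup>2 * (kappa_star \<alpha> \<beta> \<gamma> \<delta> - \<kappa>) * (norm ((u + v) - (u' + v')))\<^sup>2
      + \<kappa> * (\<gamma> + \<delta>) / (2 * (\<alpha> + \<beta>)) *
        (norm ((\<gamma> + 2 * \<alpha> - \<delta>) *\<^sub>R (u - u') - (\<delta> + 2 * \<beta> - \<gamma>) *\<^sub>R (v - v')))\<^sup>2)
      \<le> (norm (x - x'))\<^sup>2"
proof -
  define a where "a = y - y'"
  define f where "f = u - u'"
  define g where "g = v - v'"
  define r where "r = \<kappa> * (\<gamma> + \<delta>)"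
  define w where "w = (norm ((\<gamma> + 2 * \<alpha> - \<delta>) *\<^sub>R f - (\<delta> + 2 * \<beta> - \<gamma>) *\<^sub>R g))\<^sup>2"
  have r: "r \<ge> 0" using params by (simp add: r_def)
  have "(\<gamma> + \<delta>) * kappa_star \<alpha> \<beta> \<gamma> \<delta> / 2 * (norm (f + g))\<^sup>2 + w / (4 * (\<alpha> + \<beta>)) =
      (\<gamma> + \<alpha>) * (norm f)\<^sup>2 + (\<delta> + \<beta>) * (norm g)\<^sup>2 + (\<gamma> + \<delta>) * inner f g"
    unfolding w_def by (rule quadratic_form_identity[OF params(1-3) params(4)[rule_format], symmetric])
  \<comment> \<open>Sum of the comonotonicity inequalities of \<open>A\<close> and \<open>B\<close>,
    the latter at points whose difference is \<open>a - \<delta> *\<^sub>R (f + g)\<close>. The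
    right-hand side is the cross term in the expansion of the squared distance after the
    step.\<close>
  also have "\<dots> \<le> inner (a + \<gamma> *\<^sub>R f) (f + g)"
  proof -
    have "\<alpha> * (norm f)\<^sup>2 \<le> inner a f" unfolding a_def f_def by (rule comonotoneD[OF A u u'])
    moreover have "(y - \<delta> *\<^sub>R (u + v)) - (y' - \<delta> *\<^sub>R (u' + v')) = a - \<delta> *\<^sub>R (f + g)"
      by (simp add: a_def f_def g_def algebra_simps)
    then have "\<beta> * (norm g)\<^sup>2 \<le> inner (a - \<delta> *\<^sub>R (f + g)) g"
      using comonotoneD[OF B v v'] by (simp add: g_def)
    moreover have "inner (a + \<gamma> *\<^sub>R f) (f + g) = inner a f + inner (a - \<delta> *\<^sub>R (f + g)) g
        + \<gamma> * (norm f)\<^sup>2 + \<delta> * (norm g)\<^sup>2 + (\<gamma> + \<delta>) * inner f g"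
      by (simp add: power2_norm_eq_inner inner_add inner_diff inner_commute algebra_simps)
    ultimately show ?thesis by (simp add: algebra_simps)
  qed
  finally have "2 * r * ((\<gamma> + \<delta>) * kappa_star \<alpha> \<beta> \<gamma> \<delta> / 2 * (norm (f + g))\<^sup>2 + w / (4 * (\<alpha> + \<beta>)))
      \<le> 2 * r * inner (a + \<gamma> *\<^sub>R f) (f + g)"
    using r by (intro mult_left_mono) simp_all
  moreover have "2 * r * ((\<gamma> + \<delta>) * kappa_star \<alpha> \<beta> \<gamma> \<delta> / 2 * (norm (f + g))\<^sup>2 + w / (4 * (\<alpha> + \<beta>))) =
      r * (\<gamma> + \<delta>) * kappa_star \<alpha> \<beta> \<gamma> \<delta> * (norm (f + g))\<^sup>2 + r / (2 * (\<alpha> + \<beta>)) * w"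
  proof -
    \<comment> \<open>If \<open>\<alpha> + \<beta> = 0\<close>, both sides are 0 by division by
      zero.\<close>
    have "2 * r * (w / (4 * (\<alpha> + \<beta>))) = r / (2 * (\<alpha> + \<beta>)) * w"
      by (cases "\<alpha> + \<beta> = 0") (simp_all add: divide_simps)
    then show ?thesis unfolding distrib_left[of "2 * r"] by simp
  qed
  moreover have "(norm ((a + \<gamma> *\<^sub>R f) - r *\<^sub>R (f + g)))\<^sup>2 =
      (norm (a + \<gamma> *\<^sub>R f))\<^sup>2 - 2 * r * inner (a + \<gamma> *\<^sub>R f) (f + g) + r\<^sup>2 * (norm (f + g))\<^sup>2"
    by (simp only: power2_norm_eq_inner inner_diff inner_scaleR_left inner_scaleR_right
        inner_commute[of "f + g" "a + \<gamma> *\<^sub>R f"]) algebra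
  moreover have "\<kappa> * (\<gamma> + \<delta>)\<^sup>2 * (kappa_star \<alpha> \<beta> \<gamma> \<delta> - \<kappa>) * (norm (f + g))\<^sup>2 =
      r * (\<gamma> + \<delta>) * kappa_star \<alpha> \<beta> \<gamma> \<delta> * (norm (f + g))\<^sup>2 - r\<^sup>2 * (norm (f + g))\<^sup>2"
    unfolding r_def by algebra
  ultimately have "(norm ((a + \<gamma> *\<^sub>R f) - r *\<^sub>R (f + g)))\<^sup>2
      + (\<kappa> * (\<gamma> + \<delta>)\<^sup>2 * (kappa_star \<alpha> \<beta> \<gamma> \<delta> - \<kappa>) * (norm (f + g))\<^sup>2 + r / (2 * (\<alpha> + \<beta>)) * w)
      \<le> (norm (a + \<gamma> *\<^sub>R f))\<^sup>2"
    by linarith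
  moreover have "(x - r *\<^sub>R (u + v)) - (x' - r *\<^sub>R (u' + v')) = (a + \<gamma> *\<^sub>R f) - r *\<^sub>R (f + g)"
      "x - x' = a + \<gamma> *\<^sub>R f" "(u + v) - (u' + v') = f + g"
    by (simp_all add: x_def x'_def a_def f_def g_def algebra_simps)
  ultimately show ?thesis by (simp only: w_def f_def[symmetric] g_def[symmetric] r_def[symmetric])
qed

section \<open>Yosida values, the rate criterion and a sign condition\<close>

lemma yosida_singleton:
  assumes "resolvent \<gamma> A x = {p}"
  shows "yosida \<gamma> A x = {(1 / \<gamma>) *\<^sub>R (x - p)}"
  by (simp add: yosida_def op_scale_def op_add_def op_id_def assms)

lemma smallo_inverse_sqrt:
  fixes d :: "nat \<Rightarrow> real"
  assumes "decseq d" and nonneg: "\<And>k. 0 \<le> d k" and "summable (\<lambda>k. (d k)\<^sup>2)"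
  shows "d \<in> o(\<lambda>k. 1 / sqrt (real k))"
proof (rule smalloI_tendsto)
  have "decseq (\<lambda>k. (d k)\<^sup>2)"
    using assms(1) nonneg by (auto simp: decseq_def intro: power_mono)
  then have "(\<lambda>k. sqrt (real k * (d k)\<^sup>2)) \<longlonglongrightarrow> sqrt 0"
    by (intro tendsto_real_sqrt decseq_summable_imp_times_tendsto_0 assms(3)) simp_all
  \<comment> \<open>At \<open>k = 0\<close> both sides are 0, the right one by division by
    zero.\<close>
  moreover have "sqrt (real k * (d k)\<^sup>2) = d k / (1 / sqrt (real k))" for k
    using nonneg[of k] by (simp add: real_sqrt_mult)
  ultimately show "(\<lambda>k. d k / (1 / sqrt (real k))) \<longlonglongrightarrow> 0" by simp
  show "\<forall>\<^sub>F k in sequentially. 1 / sqrt (real k) \<noteq> 0"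
    using eventually_gt_at_top[of 0] by eventually_elim simp
qed

text \<open>For \<open>\<alpha> + \<beta> = 0\<close> the number is
  \<open>(\<gamma> + \<delta>) / 2\<close>. Otherwise \<open>\<gamma> + \<alpha>\<close> and
  \<open>\<delta> + \<beta>\<close> have positive product and positive sum. The sign makes the
  resolvent of \<open>A\<close> Lipschitz and at most single-valued.\<close>

lemma gamma_add_alpha_pos:
  fixes \<alpha> \<beta> \<gamma> \<delta> :: real
  assumes "\<alpha> + \<beta> \<ge> 0" and "\<gamma> > 0" and "\<delta> > 0" and "\<alpha> + \<beta> = 0 \<Longrightarrow> \<delta> = \<gamma> + 2 * \<alpha>"
    and "\<alpha> + \<beta> > 0 \<Longrightarrow> (\<gamma> + \<delta>)\<^sup>2 < 4 * (\<gamma> + \<alpha>) * (\<delta> + \<beta>)"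
  shows "\<gamma> + \<alpha> > 0"
proof (cases "\<alpha> + \<beta> = 0")
  case True
  then show ?thesis using assms(2,3,4) by simp
next
  case False
  then have "0 < 4 * (\<gamma> + \<alpha>) * (\<delta> + \<beta>)"
    using assms(1,5) zero_le_power2[of "\<gamma> + \<delta>"] by linarith
  then have "0 < (\<gamma> + \<alpha>) * (\<delta> + \<beta>)" by (simp only: mult.assoc zero_less_mult_iff) simp
  moreover have "0 < (\<gamma> + \<alpha>) + (\<delta> + \<beta>)" using assms(1-3) by linarith
  ultimately show ?thesis by (auto simp: zero_less_mult_iff)
qed

section \<open>Convergence of the adaptive Douglas-Rachford iteration\<close>

theorem theorem3p3:
  fixes A B :: "'a::{real_inner, complete_space} operator"
    and \<alpha> \<beta> \<gamma> \<delta> lam \<mu> \<kappa> :: real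
    and x y z :: "nat \<Rightarrow> 'a"
  assumes "maximal_comonotone \<alpha> A" and "maximal_comonotone \<beta> B"
    and "\<alpha> + \<beta> \<ge> 0"
    and "zer (op_add A B) \<noteq> {}"
    and "\<gamma> > 0" and "\<delta> > 0" and "lam > 1" and "\<mu> > 1"
    and "(lam - 1) * (\<mu> - 1) = 1" and "\<delta> = \<gamma> * (lam - 1)"
    and "\<alpha> + \<beta> = 0 \<Longrightarrow> \<delta> = \<gamma> + 2 * \<alpha>"
    and "\<alpha> + \<beta> > 0 \<Longrightarrow> (\<gamma> + \<delta>)\<^sup>2 < 4 * (\<gamma> + \<alpha>) * (\<delta> + \<beta>)"
    and "0 < \<kappa>" and "\<kappa> < kappa_star \<alpha> \<beta> \<gamma> \<delta>"
    and "\<And>k. y k \<in> resolvent \<gamma> A (x k)"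
    and "\<And>k. z k \<in> resolvent \<delta> B ((1 - lam) *\<^sub>R x k + lam *\<^sub>R y k)"
    and "\<And>k. x (Suc k) = x k + (\<kappa> * \<mu>) *\<^sub>R (z k - y k)"
  shows "\<exists>xbar p.
      (xbar \<in> Fix (adaptive_DR \<gamma> \<delta> lam \<mu> \<kappa> A B) \<and>
       resolvent \<gamma> A xbar = {p} \<and> p \<in> zer (op_add A B) \<and>
       weakly_converges x xbar) \<and>
      ((\<lambda>k. norm (x k - x (Suc k))) \<in> o(\<lambda>k. 1 / sqrt (real k)) \<and>
       (\<lambda>k. norm (y k - y (Suc k))) \<in> o(\<lambda>k. 1 / sqrt (real k))) \<and>
      (weakly_converges y p \<and> weakly_converges z p) \<and>
      (\<alpha> + \<beta> > 0 \<and> 0 < \<kappa> \<and> \<kappa> < 1 \<and>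
       ((\<gamma> + 2 * \<alpha> > 0 \<and> kappa_star \<alpha> \<beta> \<gamma> \<delta> \<ge> 1) \<or>
        (\<gamma> = \<delta> \<and> \<delta> > 0 \<and> lam = 2 \<and> \<mu> = 2 \<and> kappa_star \<alpha> \<beta> \<gamma> \<delta> > \<kappa>))
       \<longrightarrow>
       (\<exists>v. yosida \<gamma> A xbar = {v} \<and> \<gamma> *\<^sub>R v = xbar - p \<and>
          (\<lambda>k. x k - y k) \<longlonglongrightarrow> \<gamma> *\<^sub>R v \<and>
          (\<lambda>k. x k - z k) \<longlonglongrightarrow> \<gamma> *\<^sub>R v \<and>
          {\<gamma> *\<^sub>R v + q |q. q \<in> zer (op_add A B)} = Fix (adaptive_DR \<gamma> \<delta> lam \<mu> \<kappa> A B)))"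
proof -
  have A: "comonotone \<alpha> A" and B: "comonotone \<beta> B"
    using assms(1,2) by (simp_all add: maximal_comonotone_def)
  have R: "\<gamma> + \<delta> > 0" and P: "\<gamma> + \<alpha> > 0"
    using gamma_add_alpha_pos[OF assms(3,5,6,11,12)] assms(5,6) by simp_all
  \<comment> \<open>Since \<open>z k - y k\<close> will be \<open>- \<delta> *\<^sub>R e k\<close>,
    this converts the factor \<open>\<kappa> * \<mu>\<close> of the iteration into the step length
    \<open>\<kappa> * (\<gamma> + \<delta>)\<close> along \<open>e k\<close>.\<close>
  have mu_delta: "\<mu> * \<delta> = \<gamma> + \<delta>"
  proof -
    have "\<mu> * \<delta> = \<gamma> * ((lam - 1) * (\<mu> - 1)) + \<gamma> * (lam - 1)"
      unfolding assms(10) by algebra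
    then show ?thesis by (simp only: assms(9) assms(10)[symmetric] mult_1_right)
  qed
  define u where "u k = (1 / \<gamma>) *\<^sub>R (x k - y k)" for k
  define v where "v k = (1 / \<delta>) *\<^sub>R (((1 - lam) *\<^sub>R x k + lam *\<^sub>R y k) - z k)" for k
  define e where "e k = u k + v k" for k
  have u: "u k \<in> A (y k)" and v: "v k \<in> B (z k)" for k
    using assms(15)[of k] assms(16)[of k] assms(5,6) by (simp_all add: mem_resolvent_iff u_def v_def)
  have xk: "x k = y k + \<gamma> *\<^sub>R u k" for k using assms(5) by (simp add: u_def)
  have zk: "z k = y k - \<delta> *\<^sub>R e k" for k
  proof -
    have "(1 - lam) *\<^sub>R x k + lam *\<^sub>R y k = y k - \<delta> *\<^sub>R u k"
      unfolding xk assms(10) by (simp add: algebra_simps)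
    then have "\<delta> *\<^sub>R v k = (y k - \<delta> *\<^sub>R u k) - z k"
      using assms(6) by (simp add: v_def)
    then show ?thesis by (simp add: e_def scaleR_add_right)
  qed
  have x_Suc: "x (Suc k) = x k - (\<kappa> * (\<gamma> + \<delta>)) *\<^sub>R e k" for k
    unfolding assms(17) zk mu_delta[symmetric] by (simp add: mult.assoc)
  define c where "c = \<kappa> * (\<gamma> + \<delta>)\<^sup>2 * (kappa_star \<alpha> \<beta> \<gamma> \<delta> - \<kappa>)"
  define s where "s = \<kappa> * (\<gamma> + \<delta>) / (2 * (\<alpha> + \<beta>))"
  \<comment> \<open>Here \<open>p\<close> is the reference element of \<open>A\<close>; its partner
    in \<open>B\<close> is \<open>- p\<close>, whence the plus sign in
    \<open>v k + p\<close>.\<close>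
  define W where "W p k = (\<gamma> + 2 * \<alpha> - \<delta>) *\<^sub>R (u k - p) - (\<delta> + 2 * \<beta> - \<gamma>) *\<^sub>R (v k + p)" for p k
  have c: "c > 0" using assms(13,14) R by (simp add: c_def)
  have s: "s \<ge> 0" using assms(3,13) R by (simp add: s_def)
  have vB: "v k \<in> B (y k - \<delta> *\<^sub>R (u k + v k))" for k
    using v[of k] unfolding zk e_def .
  have balance: "\<alpha> + \<beta> = 0 \<longrightarrow> \<delta> = \<gamma> + 2 * \<alpha>" using assms(11) by blast
  note step = adaptive_DR_step[OF A B assms(3,5,6) balance less_imp_le[OF assms(13)] u vB]
  \<comment> \<open>The reference trajectory is stationary: with \<open>q\<close> and
    \<open>- q\<close> the increment \<open>u' + v'\<close> vanishes and both graph points sit over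
    \<open>p\<close>.\<close>
  have fejer: "(norm (x (Suc k) - (p + \<gamma> *\<^sub>R q)))\<^sup>2 + (c * (norm (e k))\<^sup>2 + s * (norm (W q k))\<^sup>2)
      \<le> (norm (x k - (p + \<gamma> *\<^sub>R q)))\<^sup>2" if "q \<in> A p" "- q \<in> B p" for p q k
    using step[of q p "- q" k] that
    unfolding xk[symmetric] e_def[symmetric] x_Suc[symmetric] c_def[symmetric] s_def[symmetric]
    by (simp add: W_def)
  define S where "S = {p + \<gamma> *\<^sub>R q | p q. q \<in> A p \<and> - q \<in> B p}"
  obtain p0 q0 where pq0: "q0 \<in> A p0" "- q0 \<in> B p0"
    using assms(4) zer_op_add_iff[of _ A B] by blast
  have slack: "summable (\<lambda>k. c * (norm (e k))\<^sup>2 + s * (norm (W q k))\<^sup>2)"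
    if "q \<in> A p" "- q \<in> B p" for p q
    by (rule summable_telescoping_bound[where a = "\<lambda>k. (norm (x k - (p + \<gamma> *\<^sub>R q)))\<^sup>2"])
      (use fejer[OF that] c s in auto)
  have "summable (\<lambda>k. c * (norm (e k))\<^sup>2)"
    by (rule summable_comparison_test'[OF slack[OF pq0], of 0]) (use c s in auto)
  then have sum_e: "summable (\<lambda>k. (norm (e k))\<^sup>2)"
    using c by (simp add: summable_cmult_iff)
  then have e: "e \<longlonglongrightarrow> 0" by (rule summable_norm_square_imp_tendsto_0)
  have zy: "(\<lambda>k. z k - y k) \<longlonglongrightarrow> 0"
    using tendsto_scaleR[OF tendsto_const[of "- \<delta>"] e] by (simp add: zk)

  \<comment> \<open>Rates of the increments\<close>
  have x_diff: "norm (x k - x (Suc k)) = \<kappa> * (\<gamma> + \<delta>) * norm (e k)" for k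
    using assms(13) R by (simp add: x_Suc)
  have "decseq (\<lambda>k. norm (x k - x (Suc k)))"
  proof (rule decseq_SucI)
    fix k
    \<comment> \<open>The sequence is compared with its own shift by one index.\<close>
    have "(norm (x (Suc k) - x (Suc (Suc k))))\<^sup>2 + (c * (norm (e k - e (Suc k)))\<^sup>2
        + s * (norm ((\<gamma> + 2 * \<alpha> - \<delta>) *\<^sub>R (u k - u (Suc k)) - (\<delta> + 2 * \<beta> - \<gamma>) *\<^sub>R (v k - v (Suc k))))\<^sup>2)
        \<le> (norm (x k - x (Suc k)))\<^sup>2"
      using step[OF u[of "Suc k"] vB[of "Suc k"], of k]
      unfolding xk[symmetric] e_def[symmetric] x_Suc[symmetric] c_def[symmetric] s_def[symmetric] .
    moreover have "0 \<le> c * (norm (e k - e (Suc k)))\<^sup>2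
        + s * (norm ((\<gamma> + 2 * \<alpha> - \<delta>) *\<^sub>R (u k - u (Suc k)) - (\<delta> + 2 * \<beta> - \<gamma>) *\<^sub>R (v k - v (Suc k))))\<^sup>2"
      using c s by simp
    ultimately have "(norm (x (Suc k) - x (Suc (Suc k))))\<^sup>2 \<le> (norm (x k - x (Suc k)))\<^sup>2" by linarith
    then show "norm (x (Suc k) - x (Suc (Suc k))) \<le> norm (x k - x (Suc k))"
      by (rule power2_le_imp_le) simp
  qed
  moreover have "summable (\<lambda>k. (norm (x k - x (Suc k)))\<^sup>2)"
    unfolding x_diff power_mult_distrib by (intro summable_mult sum_e)
  ultimately have x_rate: "(\<lambda>k. norm (x k - x (Suc k))) \<in> o(\<lambda>k. 1 / sqrt (real k))"
    by (intro smallo_inverse_sqrt) simp_all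
  have "(\<lambda>k. norm (y k - y (Suc k))) \<in> O(\<lambda>k. norm (x k - x (Suc k)))"
    by (rule bigoI[where c = "1 + \<gamma> / (\<gamma> + \<alpha>)"])
      (use resolvent_lipschitz[OF A assms(5) P assms(15,15)] in simp)
  then have y_rate: "(\<lambda>k. norm (y k - y (Suc k))) \<in> o(\<lambda>k. 1 / sqrt (real k))"
    using x_rate by (rule landau_o.big_small_trans)

  \<comment> \<open>Fejer monotonicity and boundedness\<close>
  have fejer_norm: "norm (x (Suc k) - a) \<le> norm (x k - a)" if aS: "a \<in> S" for a k
  proof -
    obtain p q where pq: "q \<in> A p" "- q \<in> B p" "a = p + \<gamma> *\<^sub>R q" using aS unfolding S_def by blast
    have "0 \<le> c * (norm (e k))\<^sup>2 + s * (norm (W q k))\<^sup>2" using c s by simp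
    then have "(norm (x (Suc k) - a))\<^sup>2 \<le> (norm (x k - a))\<^sup>2"
      using fejer[OF pq(1,2), of k] unfolding pq(3) by linarith
    then show ?thesis by (rule power2_le_imp_le) simp
  qed
  define s0 where "s0 = p0 + \<gamma> *\<^sub>R q0"
  have s0: "s0 \<in> S" using pq0 unfolding S_def s0_def by blast
  have x_bound: "norm (x k - s0) \<le> norm (x 0 - s0)" for k
    using decseqD[OF decseq_SucI[of "\<lambda>k. norm (x k - s0)", OF fejer_norm[OF s0]], of 0 k] by simp
  have u_bound: "norm (u k) \<le> norm (x 0 - s0) / (\<gamma> + \<alpha>) + norm q0" for k
  proof -
    have "norm (u k - q0) \<le> norm (x k - s0) / (\<gamma> + \<alpha>)"
      using yosida_slope_bound[OF A P u[of k] pq0(1)] unfolding xk[symmetric] s0_def .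
    also have "\<dots> \<le> norm (x 0 - s0) / (\<gamma> + \<alpha>)"
      using x_bound[of k] P by (simp add: divide_right_mono)
    finally show ?thesis using norm_triangle_sub[of "u k" q0] by linarith
  qed
  then have bdd_u: "bounded (range u)" by (auto simp: bounded_iff)
  have "norm (y k) \<le> norm (x 0 - s0) + norm s0 + \<gamma> * (norm (x 0 - s0) / (\<gamma> + \<alpha>) + norm q0)" for k
  proof -
    have "norm (y k) \<le> norm (x k) + norm (\<gamma> *\<^sub>R u k)"
      using norm_triangle_ineq4[of "x k" "\<gamma> *\<^sub>R u k"] xk[of k] by simp
    moreover have "norm (x k) \<le> norm (x 0 - s0) + norm s0"
      using norm_triangle_sub[of "x k" s0] x_bound[of k] by linarith
    moreover have "norm (\<gamma> *\<^sub>R u k) \<le> \<gamma> * (norm (x 0 - s0) / (\<gamma> + \<alpha>) + norm q0)"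
      using mult_left_mono[OF u_bound[of k], of \<gamma>] assms(5) by simp
    ultimately show ?thesis by linarith
  qed
  then have bdd_y: "bounded (range y)" by (auto simp: bounded_iff)

  \<comment> \<open>Weak cluster points and weak convergence\<close>
  have cluster_graph: "q \<in> A p \<and> - q \<in> B p"
    if r: "strict_mono r" and "weakly_converges (y \<circ> r) p" "weakly_converges (u \<circ> r) q" for r p q
  proof (rule weak_limit_in_graphs[OF assms(1,2,3), where u = "u \<circ> r" and v = "v \<circ> r"
        and y = "y \<circ> r" and z = "z \<circ> r"])
    show "bounded (range (u \<circ> r))" by (rule bounded_subset[OF bdd_u]) auto
    show "bounded (range (y \<circ> r))" by (rule bounded_subset[OF bdd_y]) auto
    show "(\<lambda>k. (z \<circ> r) k - (y \<circ> r) k) \<longlonglongrightarrow> 0" "(\<lambda>k. (u \<circ> r) k + (v \<circ> r) k) \<longlonglongrightarrow> 0"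
      using LIMSEQ_subseq_LIMSEQ[OF zy r] LIMSEQ_subseq_LIMSEQ[OF e r] by (simp_all add: o_def e_def)
  qed (use u v that in auto)
  have "\<exists>l\<in>S. weakly_converges x l"
  proof (rule opial)
    show "S \<noteq> {}" using s0 by blast
    fix r a assume r: "strict_mono (r :: nat \<Rightarrow> nat)" "weakly_converges (x \<circ> r) a"
    have "bounded (range (u \<circ> r))" by (rule bounded_subset[OF bdd_u]) auto
    then obtain q r' where r': "strict_mono r'" "weakly_converges ((u \<circ> r) \<circ> r') q"
      using bounded_imp_weakly_convergent_subseq by blast
    \<comment> \<open>A further subsequence makes \<open>u\<close> converge weakly too; then
      \<open>y = x - \<gamma> u\<close> has the weak limit \<open>a - \<gamma> *\<^sub>R q\<close>,
      and \<open>a\<close> takes the form required in \<open>S\<close>.\<close>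
    have "weakly_converges (\<lambda>k. (x \<circ> r \<circ> r') k + (- \<gamma>) *\<^sub>R (u \<circ> r \<circ> r') k) (a + (- \<gamma>) *\<^sub>R q)"
      by (intro weakly_converges_add_scaleR weakly_converges_subseq r' r(2))
    then have "weakly_converges (y \<circ> (r \<circ> r')) (a - \<gamma> *\<^sub>R q)"
      by (simp add: o_def xk)
    moreover have "weakly_converges (u \<circ> (r \<circ> r')) q" using r'(2) by (simp add: o_assoc)
    ultimately have "q \<in> A (a - \<gamma> *\<^sub>R q) \<and> - q \<in> B (a - \<gamma> *\<^sub>R q)"
      by (rule cluster_graph[OF strict_mono_o[OF r(1) r'(1)]])
    moreover have "a = (a - \<gamma> *\<^sub>R q) + \<gamma> *\<^sub>R q" by simp
    ultimately show "a \<in> S" unfolding S_def by blast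
  qed (rule fejer_norm)
  then obtain p q xbar where pq: "q \<in> A p" "- q \<in> B p" and xbar: "xbar = p + \<gamma> *\<^sub>R q"
    and x_weak: "weakly_converges x xbar"
    unfolding S_def by blast
  have Fix_S: "Fix (adaptive_DR \<gamma> \<delta> lam \<mu> \<kappa> A B) = S"
    unfolding S_def using mem_Fix_adaptive_DR_iff[OF assms(5,6,7,8,9,10,13)] by blast
  have "xbar \<in> S" unfolding S_def using pq xbar by blast
  then have xbar_Fix: "xbar \<in> Fix (adaptive_DR \<gamma> \<delta> lam \<mu> \<kappa> A B)" by (simp add: Fix_S)
  have "p \<in> resolvent \<gamma> A xbar"
    using pq(1) assms(5) by (simp add: xbar mem_resolvent_iff)
  then have res: "resolvent \<gamma> A xbar = {p}" by (rule resolvent_singleton[OF A assms(5) P])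
  have p_zer: "p \<in> zer (op_add A B)" using pq zer_op_add_iff by blast
  have y_weak: "weakly_converges y p"
  proof (rule weakly_convergesI_subseq[OF bdd_y])
    fix r a assume r: "strict_mono (r :: nat \<Rightarrow> nat)" "weakly_converges (y \<circ> r) a"
    \<comment> \<open>As \<open>x\<close> converges weakly, the cluster point \<open>a\<close> of
      \<open>y\<close> fixes the weak limit of \<open>u\<close>. The limit pair lies in the graph of
      \<open>A\<close>, which makes \<open>a\<close> a resolvent value at \<open>xbar\<close>. The
      constant zero sequence below turns the rule for sums into one for scalar multiples.\<close>
    have "weakly_converges (\<lambda>k. (x \<circ> r) k + (- 1) *\<^sub>R (y \<circ> r) k) (xbar + (- 1) *\<^sub>R a)"
      by (intro weakly_converges_add_scaleR weakly_converges_subseq[OF x_weak] r)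
    from weakly_converges_add_scaleR[OF tendsto_imp_weakly_converges[OF tendsto_const[of 0]] this, of "1 / \<gamma>"]
    have "weakly_converges (u \<circ> r) ((1 / \<gamma>) *\<^sub>R (xbar - a))" by (simp add: o_def u_def)
    from cluster_graph[OF r this] have "a \<in> resolvent \<gamma> A xbar"
      by (simp add: mem_resolvent_iff assms(5))
    then show "a = p" by (simp add: res)
  qed
  have z_weak: "weakly_converges z p"
    using weakly_converges_add_scaleR[OF y_weak tendsto_imp_weakly_converges[OF e], of "- \<delta>"]
    by (simp add: zk[abs_def])

  \<comment> \<open>Strong convergence and the structure of the fixed points\<close>
  have strong: "\<exists>v. yosida \<gamma> A xbar = {v} \<and> \<gamma> *\<^sub>R v = xbar - p \<and>
          (\<lambda>k. x k - y k) \<longlonglongrightarrow> \<gamma> *\<^sub>R v \<and>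
          (\<lambda>k. x k - z k) \<longlonglongrightarrow> \<gamma> *\<^sub>R v \<and>
          {\<gamma> *\<^sub>R v + q |q. q \<in> zer (op_add A B)} = Fix (adaptive_DR \<gamma> \<delta> lam \<mu> \<kappa> A B)"
    if ab: "\<alpha> + \<beta> > 0"
  proof (intro exI[of _ q] conjI)
    show "yosida \<gamma> A xbar = {q}"
      using yosida_singleton[OF res] assms(5) by (simp add: xbar)
    show "\<gamma> *\<^sub>R q = xbar - p" by (simp add: xbar)
    have "s > 0" using ab assms(13) R by (simp add: s_def)
    have "summable (\<lambda>k. s * (norm (W q k))\<^sup>2)"
      by (rule summable_comparison_test'[OF slack[OF pq], of 0]) (use c s in auto)
    then have W: "W q \<longlonglongrightarrow> 0"
      using \<open>s > 0\<close> by (intro summable_norm_square_imp_tendsto_0) (simp add: summable_cmult_iff)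
    \<comment> \<open>Adding \<open>(\<delta> + 2 * \<beta> - \<gamma>) *\<^sub>R e k\<close> to
      \<open>W q k\<close> eliminates \<open>v k\<close>, and the coefficients of \<open>u k\<close>
      add up to \<open>2 * (\<alpha> + \<beta>)\<close>.\<close>
    have u_eq: "u k = (1 / (2 * (\<alpha> + \<beta>))) *\<^sub>R (W q k + (\<delta> + 2 * \<beta> - \<gamma>) *\<^sub>R e k) + q" for k
    proof -
      have "W q k + (\<delta> + 2 * \<beta> - \<gamma>) *\<^sub>R e k = (2 * (\<alpha> + \<beta>)) *\<^sub>R (u k - q)"
        by (simp add: W_def e_def algebra_simps)
      then show ?thesis using ab by simp
    qed
    have "(\<lambda>k. (1 / (2 * (\<alpha> + \<beta>))) *\<^sub>R (W q k + (\<delta> + 2 * \<beta> - \<gamma>) *\<^sub>R e k) + q)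
        \<longlonglongrightarrow> (1 / (2 * (\<alpha> + \<beta>))) *\<^sub>R (0 + (\<delta> + 2 * \<beta> - \<gamma>) *\<^sub>R 0) + q"
      by (intro tendsto_intros W e)
    then have u_lim: "u \<longlonglongrightarrow> q" by (simp only: u_eq[symmetric] scaleR_zero_right add_0)
    have "(\<lambda>k. \<gamma> *\<^sub>R u k) \<longlonglongrightarrow> \<gamma> *\<^sub>R q" by (intro tendsto_intros u_lim)
    then show "(\<lambda>k. x k - y k) \<longlonglongrightarrow> \<gamma> *\<^sub>R q" by (simp add: xk)
    from tendsto_diff[OF this zy] show "(\<lambda>k. x k - z k) \<longlonglongrightarrow> \<gamma> *\<^sub>R q" by simp
    \<comment> \<open>In the sum of the two comonotonicity inequalities the inner products cancel,
      leaving \<open>(\<alpha> + \<beta>) * (norm (q - q'))\<^sup>2 \<le> 0\<close>. All fixed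
      points thus share one \<open>q\<close>, which makes their set a translate of the
      zeros.\<close>
    have q_unique: "q' = q" if "q' \<in> A p'" "- q' \<in> B p'" for p' q'
    proof -
      have neg: "- q - - q' = - (q - q')" by simp
      have "\<alpha> * (norm (q - q'))\<^sup>2 \<le> inner (p - p') (q - q')"
        by (rule comonotoneD[OF A pq(1) that(1)])
      moreover have "\<beta> * (norm (q - q'))\<^sup>2 \<le> - inner (p - p') (q - q')"
        using comonotoneD[OF B pq(2) that(2)] unfolding neg norm_minus_cancel inner_minus_right .
      ultimately have "(\<alpha> + \<beta>) * (norm (q - q'))\<^sup>2 \<le> 0" by (simp add: distrib_right)
      then show ?thesis using ab by (simp add: mult_le_0_iff)
    qed
    show "{\<gamma> *\<^sub>R q + q' |q'. q' \<in> zer (op_add A B)} = Fix (adaptive_DR \<gamma> \<delta> lam \<mu> \<kappa> A B)"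
      unfolding Fix_S S_def
    proof (intro equalityI subsetI)
      fix a assume "a \<in> {\<gamma> *\<^sub>R q + q' |q'. q' \<in> zer (op_add A B)}"
      then obtain p' where a: "a = \<gamma> *\<^sub>R q + p'" and "p' \<in> zer (op_add A B)" by blast
      then obtain q' where q': "q' \<in> A p'" "- q' \<in> B p'" using zer_op_add_iff by blast
      have "a = p' + \<gamma> *\<^sub>R q'" unfolding a q_unique[OF q'] by (rule add.commute)
      then show "a \<in> {p + \<gamma> *\<^sub>R q |p q. q \<in> A p \<and> - q \<in> B p}"
        using q' by blast
    next
      fix a assume "a \<in> {p + \<gamma> *\<^sub>R q |p q. q \<in> A p \<and> - q \<in> B p}"
      then obtain p' q' where a: "a = p' + \<gamma> *\<^sub>R q'" and q': "q' \<in> A p'" "- q' \<in> B p'" by blast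
      then have "a = \<gamma> *\<^sub>R q + p'" unfolding q_unique[OF q'] by (simp only: add.commute)
      moreover have "p' \<in> zer (op_add A B)" using q' zer_op_add_iff by blast
      ultimately show "a \<in> {\<gamma> *\<^sub>R q + q' |q'. q' \<in> zer (op_add A B)}" by blast
    qed
  qed
  show ?thesis
    by (rule exI[of _ xbar], rule exI[of _ p], intro conjI impI;
      (fact xbar_Fix res p_zer x_weak x_rate y_rate y_weak z_weak | (rule strong, blast)))
qed

end
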